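(* For every integer $d\ge1$, the range of the generic $f\in\mathcal{C}^d$ has topological Hausdorff dimension $1$; that is, $\{f\in\mathcal{C}^d:\dim_{tH}f([0,1])=1\}$ is co-meager in $\mathcal{C}^d$.
   Context: $\mathcal{C}^d$ is the space of all continuous maps $f\colon[0,1]\to\mathbb{R}^d$ with the supremum metric (a complete metric space). A set is co-meager if its complement is a countable union of nowhere dense sets. $\dim_H$ denotes Hausdorff dimension, with the convention $\dim_H\emptyset=-1$. The topological Hausdorff dimension is defined by $\dim_{tH}\emptyset=-1$ and, for a non-empty metric space $X$, $\dim_{tH}X=\inf\{d: X \text{ has a basis } \mathcal U \text{ of open sets such that } \dim_H\partial U\le d-1 \text{ for every } U\in\mathcal U\}$ (where $d=\infty$ is allowed, with $\infty-1=\infty$). *)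

theory Defs
  imports "HOL-Analysis.Analysis"
begin

definition nowhere_dense_in :: "'a topology \<Rightarrow> 'a set \<Rightarrow> bool" where
  "nowhere_dense_in X S \<longleftrightarrow> S \<subseteq> topspace X \<and> X interior_of (X closure_of S) = {}"

definition comeager_in :: "'a topology \<Rightarrow> 'a set \<Rightarrow> bool" where
  "comeager_in X S \<longleftrightarrow> S \<subseteq> topspace X \<and>
     (\<exists>N :: nat \<Rightarrow> 'a set. (\<forall>n. nowhere_dense_in X (N n)) \<and> topspace X - S = (\<Union>n. N n))"

text \<open>The contribution of a covering set \<open>U\<close> to the \<open>s\<close>-dimensional Hausdorff measure is
  the \<open>s\<close>-th power of its diameter, with the usual conventions that the empty set contributes
  \<open>0\<close> and that \<open>0\<close> to the power \<open>0\<close> is \<open>1\<close> (whereas \<open>0 powr 0 = 0\<close>).\<close>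

definition diam_pow :: "real \<Rightarrow> 'a::metric_space set \<Rightarrow> ennreal" where
  "diam_pow s U = (if U = {} then 0 else if s = 0 then 1 else ennreal (diameter U powr s))"

text \<open>The library's \<^const>\<open>diameter\<close> is meaningful only for bounded sets, hence the
  boundedness condition, which is implied by a diameter of at most \<open>\<delta>\<close>. Finite covers are
  included by padding with empty sets.\<close>

definition hausdorff_premeasure :: "real \<Rightarrow> real \<Rightarrow> 'a::metric_space set \<Rightarrow> ennreal" where
  "hausdorff_premeasure s \<delta> A =
     Inf {(\<Sum>i. diam_pow s (U i)) | U :: nat \<Rightarrow> 'a set.
            A \<subseteq> (\<Union>i. U i) \<and> (\<forall>i. bounded (U i) \<and> diameter (U i) \<le> \<delta>)}"

text \<open>The premeasure increases as \<open>\<delta>\<close> decreases, so its limit as \<open>\<delta>\<close> tends to \<open>0\<close> from the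
  right is the supremum.\<close>

definition hausdorff_measure :: "real \<Rightarrow> 'a::metric_space set \<Rightarrow> ennreal" where
  "hausdorff_measure s A = (SUP \<delta>\<in>{0<..}. hausdorff_premeasure s \<delta> A)"

definition hausdorff_dim :: "'a::metric_space set \<Rightarrow> ereal" where
  "hausdorff_dim A =
     (if A = {} then - 1 else Inf {ereal s | s. 0 \<le> s \<and> hausdorff_measure s A = 0})"

definition is_basis_of :: "'a set set \<Rightarrow> 'a topology \<Rightarrow> bool" where
  "is_basis_of \<B> X \<longleftrightarrow> openin X = arbitrary union_of (\<lambda>U. U \<in> \<B>)"

text \<open>The set \<open>A\<close> is regarded as a metric space in its own right: bases and boundaries are taken
  in the subspace topology. Hausdorff dimension is unaffected by the ambient space.
  Note \<open>\<infinity> - 1 = \<infinity>\<close> in \<^typ>\<open>ereal\<close>; no lower bound on \<open>d\<close> is needed, because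
  \<^const>\<open>hausdorff_dim\<close> is at least \<open>- 1\<close> and a basis of a nonempty space is nonempty.\<close>

definition top_hausdorff_dim :: "'a::metric_space set \<Rightarrow> ereal" where
  "top_hausdorff_dim A =
     (if A = {} then - 1
      else Inf {d :: ereal. \<exists>\<U>. is_basis_of \<U> (top_of_set A) \<and>
                  (\<forall>U\<in>\<U>. hausdorff_dim (top_of_set A frontier_of U) \<le> d - 1)})"

text \<open>The space of continuous maps from \<open>[0,1]\<close> to \<open>\<real>\<^sup>d\<close> with the supremum metric. Its elements
  are functions on \<^typ>\<open>real\<close> that are \<^const>\<open>undefined\<close> outside \<open>[0,1]\<close>.\<close>

definition path_space :: "(real \<Rightarrow> real ^ 'd::finite) metric" where
  "path_space = cfunspace (top_of_set {0..1}) euclidean_metric"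

lemma mspace_path_space:
  "mspace path_space = {f :: real \<Rightarrow> real ^ 'd::finite. f \<in> extensional {0..1} \<and> continuous_on {0..1} f}"
proof -
  have "bounded (f ` {0..1})" if "continuous_on {0..1} f" for f :: "real \<Rightarrow> real ^ 'd"
    using that by (intro compact_imp_bounded compact_continuous_image) auto
  then show ?thesis
    by (auto simp: path_space_def Met_TC.fspace_def Met_TC.mbounded_def bounded_def subset_iff)
qed

lemma mdist_path_space:
  assumes "f \<in> mspace path_space" "g \<in> mspace path_space"
  shows "mdist path_space f g = (SUP t\<in>{0..1}. dist (f t) (g t :: real ^ 'd::finite))"
  using assms by (auto simp: path_space_def mdist_cfunspace_eq_mdist_funspace
      Met_TC.fdist_def Met_TC.fspace_def)

end

theory Submission
  imports Defs
begin

text \<open>A nonconstant path has a connected range with at least two points, which has no basis of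
  clopen sets; this bounds the dimension from below. For the upper bound, boxes with rational
  corners give a basis of the range whose boundaries lie in finitely many hyperplanes
  \<open>x\<^sub>i = q\<close> with \<open>q\<close> rational, so it suffices that the generic range meets each such finite grid in
  a set of Hausdorff dimension \<open>0\<close>. Being covered by finitely many balls of prescribed small total
  size is an open condition on the path, by compactness, and it is dense because a polynomial
  path, after an arbitrarily small shift, meets the grid at finitely many parameters only.\<close>

section \<open>Comeager sets in metric spaces\<close>

lemma openin_mtopology_of_iff:
  "openin (mtopology_of m) U \<longleftrightarrow>
     U \<subseteq> mspace m \<and> (\<forall>x\<in>U. \<exists>r>0. \<forall>y\<in>mspace m. mdist m x y < r \<longrightarrow> y \<in> U)"
proof -
  interpret Metric_space "mspace m" "mdist m" by simp
  show ?thesis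
    unfolding mtopology_of_def openin_mtopology by (simp add: subset_iff) blast
qed

lemma closure_of_mtopology_of_eq_mspace:
  assumes "\<And>x r. x \<in> mspace m \<Longrightarrow> r > 0 \<Longrightarrow> \<exists>y\<in>S. y \<in> mspace m \<and> mdist m x y < r"
  shows "mtopology_of m closure_of S = mspace m"
proof -
  interpret Metric_space "mspace m" "mdist m" by simp
  show ?thesis
    using assms by (auto simp: mtopology_of_def metric_closure_of)
qed

text \<open>The complement of an open dense set is closed with empty interior, and the closure of
  \<open>N\<close> stays inside it.\<close>

lemma nowhere_dense_in_subset_diff_open_dense:
  assumes "openin X U" "X closure_of U = topspace X" "N \<subseteq> topspace X - U"
  shows "nowhere_dense_in X N"
proof -
  have "X closure_of N \<subseteq> topspace X - U"
    using assms(1,3) by (intro closure_of_minimal) auto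
  then have "X interior_of (X closure_of N) \<subseteq> X interior_of (topspace X - U)"
    by (rule interior_of_mono)
  also have "\<dots> = {}"
    using assms(2) by (simp add: interior_of_complement)
  finally show ?thesis
    using assms(3) by (auto simp: nowhere_dense_in_def)
qed

text \<open>A point outside \<open>S\<close> misses some member of the family. Each nowhere dense
  piece is a complement of a member, cut down to the complement of \<open>S\<close>, so that the
  union is exactly that complement, as \<open>comeager_in\<close> demands.\<close>

lemma comeager_in_if_countable_Inter_open_dense:
  assumes "countable \<W>" "\<W> \<noteq> {}"
    and "\<And>W. W \<in> \<W> \<Longrightarrow> openin X W \<and> X closure_of W = topspace X"
    and "S \<subseteq> topspace X" "\<Inter>\<W> \<subseteq> S"
  shows "comeager_in X S"
  unfolding comeager_in_def
proof (intro conjI exI allI)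
  fix n
  show "nowhere_dense_in X (topspace X - S - from_nat_into \<W> n)"
    using assms(3)[OF from_nat_into[OF assms(2)]]
    by (intro nowhere_dense_in_subset_diff_open_dense[where U = "from_nat_into \<W> n"]) auto
next
  have "\<Inter>\<W> = (\<Inter>n. from_nat_into \<W> n)"
    using range_from_nat_into[OF assms(2,1)] by simp
  then show "topspace X - S = (\<Union>n. topspace X - S - from_nat_into \<W> n)"
    using assms(5) by auto
qed (fact assms(4))

section \<open>Dimension estimates\<close>

text \<open>The one index \<open>n\<close> bounds the diameters, the exponent and the total size
  together, so countably many conditions suffice for Hausdorff dimension at most 0. Finitely many
  open balls are used to make the condition stable under small perturbations of a compact
  set.\<close>

definition finely_covered :: "nat \<Rightarrow> 'a::metric_space set \<Rightarrow> bool" where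
  "finely_covered n A \<longleftrightarrow> (\<exists>P r. finite P \<and> 0 < r \<and> A \<subseteq> (\<Union>p\<in>P. ball p r) \<and>
     2 * r \<le> 1 / Suc n \<and> real (card P) * (2 * r) powr (1 / Suc n) \<le> 1 / Suc n)"

lemma finely_covered_mono: "finely_covered n B \<Longrightarrow> A \<subseteq> B \<Longrightarrow> finely_covered n A"
  unfolding finely_covered_def by (meson subset_trans)

text \<open>The union of the covering balls is itself such a \<open>U\<close>, with the same centres
  and radius.\<close>

lemma finely_covered_open:
  assumes "finely_covered n A"
  obtains U where "open U" "A \<subseteq> U" "finely_covered n U"
  using assms unfolding finely_covered_def by (metis open_UN open_ball order_refl)

lemma finite_imp_finely_covered:
  assumes "finite A"
  shows "finely_covered n A"
proof -
  \<comment> \<open>The points of \<open>A\<close> serve as centres. The limit is 0 because the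
    exponent is positive, so every small enough radius works.\<close>
  have "((\<lambda>r. real (card A) * (2 * r) powr (1 / Suc n)) \<longlongrightarrow> real (card A) * (2 * 0) powr (1 / Suc n)) (at_right 0)"
    by (intro tendsto_intros tendsto_powr') (auto intro: eventually_mono[OF eventually_at_right_less])
  then have "\<forall>\<^sub>F r in at_right 0. real (card A) * (2 * r) powr (1 / Suc n) < 1 / Suc n"
    by (rule order_tendstoD) simp
  moreover have "((\<lambda>r::real. 2 * r) \<longlongrightarrow> 2 * 0) (at_right 0)"
    by (intro tendsto_intros)
  then have "\<forall>\<^sub>F r in at_right 0. 2 * r < 1 / Suc n"
    by (rule order_tendstoD) simp
  moreover have "\<forall>\<^sub>F r::real in at_right 0. 0 < r"
    by (rule eventually_at_right_less)
  ultimately have "\<forall>\<^sub>F r in at_right 0. 0 < r \<and> 2 * r < 1 / Suc n \<and>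
      real (card A) * (2 * r) powr (1 / Suc n) < 1 / Suc n"
    by eventually_elim simp
  then obtain r where "0 < r" "2 * r < 1 / Suc n"
      "real (card A) * (2 * r) powr (1 / Suc n) < 1 / Suc n"
    using eventually_happens'[OF trivial_limit_at_right_real] by blast
  moreover have "A \<subseteq> (\<Union>p\<in>A. ball p r)"
    using \<open>0 < r\<close> by auto
  ultimately show ?thesis
    using assms unfolding finely_covered_def by (meson less_imp_le)
qed

lemma hausdorff_premeasure_le_card_balls:
  assumes "finite P" "0 < s" "0 < r" "2 * r \<le> \<delta>" "A \<subseteq> (\<Union>p\<in>P. ball p r)"
  shows "hausdorff_premeasure s \<delta> A \<le> ennreal (real (card P) * (2 * r) powr s)"
proof -
  obtain h where h: "bij_betw h {..<card P} P"
    using ex_bij_betw_nat_finite[OF assms(1)] by (auto simp: atLeast0LessThan)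
  \<comment> \<open>The premeasure asks for a sequence of sets, so the enumerated balls are padded
    with \<open>{}\<close>, which \<open>diam_pow\<close> counts as 0.\<close>
  define U where "U i = (if i < card P then ball (h i) r else {})" for i
  have diam: "diameter (U i) \<le> 2 * r" for i
  proof (cases "i < card P")
    case True
    have "dist x y \<le> 2 * r" if "x \<in> ball (h i) r" "y \<in> ball (h i) r" for x y
      using that dist_triangle3[of x y "h i"] by simp
    then have "diameter (ball (h i) r) \<le> 2 * r"
      unfolding diameter_def using assms(3) by (auto intro!: cSUP_least)
    then show ?thesis using True by (simp add: U_def)
  qed (use assms(3) in \<open>simp add: U_def\<close>)
  have bdd: "bounded (U i)" for i
    by (simp add: U_def)
  have "diam_pow s (U i) \<le> ennreal ((2 * r) powr s)" for i
    using diam[of i] diameter_ge_0[OF bdd] assms(2)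
    by (auto simp: diam_pow_def intro!: ennreal_leI powr_mono2)
  moreover have "(\<Sum>i. diam_pow s (U i)) = (\<Sum>i<card P. diam_pow s (U i))"
    by (intro suminf_finite) (auto simp: U_def diam_pow_def)
  ultimately have "(\<Sum>i. diam_pow s (U i)) \<le> (\<Sum>i<card P. ennreal ((2 * r) powr s))"
    by (simp only: sum_mono)
  also have "\<dots> = ennreal (real (card P) * (2 * r) powr s)"
    by (simp add: ennreal_mult ennreal_of_nat_eq_real_of_nat)
  finally have le: "(\<Sum>i. diam_pow s (U i)) \<le> ennreal (real (card P) * (2 * r) powr s)" .
  have cover: "A \<subseteq> (\<Union>i. U i)"
  proof
    fix x assume "x \<in> A"
    then have "x \<in> (\<Union>p\<in>h ` {..<card P}. ball p r)"
      using assms(5) bij_betw_imp_surj_on[OF h] by (metis subsetD)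
    then obtain i where "i < card P" "x \<in> ball (h i) r"
      by auto
    then show "x \<in> (\<Union>i. U i)" by (auto simp: U_def intro!: exI[of _ i])
  qed
  have "hausdorff_premeasure s \<delta> A \<le> (\<Sum>i. diam_pow s (U i))"
    unfolding hausdorff_premeasure_def
  proof (intro Inf_lower CollectI exI[of _ U] conjI allI)
    show "diameter (U i) \<le> \<delta>" for i
      using diam[of i] assms(4) by (rule order_trans)
  qed (simp_all add: bdd cover)
  from this le show ?thesis
    by (rule order_trans)
qed

lemma hausdorff_measure_eq_0_if_finely_covered:
  assumes "0 < s" "\<And>n. finely_covered n A"
  shows "hausdorff_measure s A = 0"
proof -
  have "hausdorff_premeasure s \<delta> A \<le> ennreal \<epsilon>" if pos: "0 < \<delta>" "0 < \<epsilon>" for \<delta> \<epsilon>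
  proof -
    obtain n where n: "1 / Suc n < min s (min \<delta> \<epsilon>)"
      using reals_Archimedean[of "min s (min \<delta> \<epsilon>)"] assms(1) pos
      unfolding inverse_eq_divide by auto
    obtain P r where P: "finite P" "0 < r" "A \<subseteq> (\<Union>p\<in>P. ball p r)" "2 * r \<le> 1 / Suc n"
        "real (card P) * (2 * r) powr (1 / Suc n) \<le> 1 / Suc n"
      using assms(2)[of n] unfolding finely_covered_def by blast
    \<comment> \<open>A base of at most 1 is needed below: raising the exponent from
      \<open>1 / Suc n\<close> to \<open>s\<close> then does not increase the power.\<close>
    have "1 / real (Suc n) \<le> 1" by simp
    then have "2 * r \<le> 1" using P(4) by linarith
    have "hausdorff_premeasure s \<delta> A \<le> ennreal (real (card P) * (2 * r) powr s)"
      using P n assms(1) by (intro hausdorff_premeasure_le_card_balls) auto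
    also have "\<dots> \<le> ennreal (real (card P) * (2 * r) powr (1 / Suc n))"
      using n P(2) \<open>2 * r \<le> 1\<close> by (intro ennreal_leI mult_left_mono powr_mono') auto
    also have "\<dots> \<le> ennreal \<epsilon>"
      using n P(5) by (intro ennreal_leI) linarith
    finally show ?thesis .
  qed
  then have "hausdorff_premeasure s \<delta> A \<le> 0" if "0 < \<delta>" for \<delta>
    using that by (intro ennreal_le_epsilon[of 0]) simp
  then have "hausdorff_measure s A \<le> 0"
    unfolding hausdorff_measure_def by (intro SUP_least) simp
  then show ?thesis by simp
qed

lemma hausdorff_dim_le_0_if_finely_covered:
  assumes "\<And>n. finely_covered n A"
  shows "hausdorff_dim A \<le> 0"
proof (cases "A = {}")
  case False
  have "hausdorff_dim A \<le> ereal s" if "0 < s" for s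
    using that False hausdorff_measure_eq_0_if_finely_covered[OF that assms]
    unfolding hausdorff_dim_def by (auto intro!: Inf_lower)
  then show ?thesis
    by (intro ereal_le_epsilon2[of _ 0]) simp
qed (simp add: hausdorff_dim_def)

section \<open>Lower bound for connected sets\<close>

lemma hausdorff_dim_nonneg:
  assumes "A \<noteq> {}"
  shows "0 \<le> hausdorff_dim A"
  using assms by (auto simp: hausdorff_dim_def intro!: Inf_greatest)

text \<open>If \<open>d < 1\<close>, the boundaries of basis sets have negative dimension and are
  therefore empty. A basis set that contains \<open>x\<close> but not \<open>y\<close> is then
  clopen, against connectedness.\<close>

lemma top_hausdorff_dim_ge_1:
  assumes "connected A" "x \<in> A" "y \<in> A" "x \<noteq> y"
  shows "1 \<le> top_hausdorff_dim A"
proof -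
  have "1 \<le> d" if basis: "is_basis_of \<U> (top_of_set A)"
    and dim: "\<forall>U\<in>\<U>. hausdorff_dim (top_of_set A frontier_of U) \<le> d - 1" for d :: ereal and \<U>
  proof (rule ccontr)
    assume "\<not> 1 \<le> d"
    then have "d - 1 < 0" by (cases d) (auto simp: one_ereal_def zero_ereal_def)
    have *: "(\<forall>U. U \<in> \<U> \<longrightarrow> openin (top_of_set A) U) \<and>
        (\<forall>V x. openin (top_of_set A) V \<and> x \<in> V \<longrightarrow> (\<exists>U. U \<in> \<U> \<and> x \<in> U \<and> U \<subseteq> V))"
      using basis unfolding is_basis_of_def openin_topology_base_unique .
    have "openin (top_of_set A) (A - {y})"
      by (intro openin_diff) (auto simp: assms)
    then obtain U where U: "U \<in> \<U>" "x \<in> U" "U \<subseteq> A - {y}" "openin (top_of_set A) U"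
      using * assms by (metis DiffI singletonD)
    have "hausdorff_dim (top_of_set A frontier_of U) < 0"
      using dim U(1) \<open>d - 1 < 0\<close> by (blast intro: le_less_trans)
    then have "top_of_set A frontier_of U = {}"
      using hausdorff_dim_nonneg by (metis not_le)
    then have "closedin (top_of_set A) U"
      using U(3) frontier_of_eq_empty[of U "top_of_set A"] by auto
    then have "U = {} \<or> U = A"
      using assms(1) U(4) unfolding connected_clopen by blast
    then show False using U(2,3) assms(3) by auto
  qed
  then show ?thesis
    using assms(2) unfolding top_hausdorff_dim_def by (auto intro!: Inf_greatest)
qed

section \<open>Rational grids and the upper bound\<close>

definition hyperplane_grid :: "real set \<Rightarrow> 'a::euclidean_space set" where
  "hyperplane_grid F = {x. \<exists>i\<in>Basis. x \<bullet> i \<in> F}"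

lemma closed_hyperplane_grid:
  assumes "finite F"
  shows "closed (hyperplane_grid F :: 'a::euclidean_space set)"
proof -
  have "hyperplane_grid F = (\<Union>i\<in>Basis. (\<lambda>x::'a. x \<bullet> i) -` F)"
    by (auto simp: hyperplane_grid_def)
  then show ?thesis
    using assms by (simp, intro closed_UN ballI closed_vimage) (auto intro: finite_imp_closed continuous_intros)
qed

text \<open>A boundary point lies in the closed box but not in the open one, so one of its
  coordinates equals that of a corner.\<close>

lemma frontier_box_subset_hyperplane_grid:
  "frontier (box a b) \<subseteq> hyperplane_grid ((\<bullet>) a ` Basis \<union> (\<bullet>) b ` Basis)"
proof
  fix x assume x: "x \<in> frontier (box a b)"
  then have "x \<in> cbox a b - box a b"
    using closure_minimal[OF box_subset_cbox closed_cbox]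
    by (auto simp: frontier_def interior_open open_box)
  then obtain i where "i \<in> Basis" "x \<bullet> i = a \<bullet> i \<or> x \<bullet> i = b \<bullet> i"
    by (force simp: mem_box)
  then show "x \<in> hyperplane_grid ((\<bullet>) a ` Basis \<union> (\<bullet>) b ` Basis)"
    unfolding hyperplane_grid_def by blast
qed

lemma top_hausdorff_dim_le_1:
  fixes A :: "'a::euclidean_space set"
  assumes "\<And>n F. finite F \<Longrightarrow> F \<subseteq> \<rat> \<Longrightarrow> finely_covered n (A \<inter> hyperplane_grid F)"
  shows "top_hausdorff_dim A \<le> 1"
proof (cases "A = {}")
  case False
  define \<U> where "\<U> = {A \<inter> box a b | a b. \<forall>i\<in>Basis. a \<bullet> i \<in> \<rat> \<and> b \<bullet> i \<in> \<rat>}"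
  have "\<exists>V. V \<in> \<U> \<and> x \<in> V \<and> V \<subseteq> U" if U: "openin (top_of_set A) U" "x \<in> U" for U x
  proof -
    obtain e where e: "e > 0" "ball x e \<inter> A \<subseteq> U" "x \<in> A"
      using U by (meson openin_contains_ball openin_imp_subset subsetD)
    obtain a b where "\<forall>i\<in>Basis. a \<bullet> i \<in> \<rat> \<and> b \<bullet> i \<in> \<rat>" "x \<in> box a b" "box a b \<subseteq> ball x e"
      using rational_boxes[OF e(1)] by blast
    then show ?thesis
      using e unfolding \<U>_def by (intro exI[of _ "A \<inter> box a b"]) blast
  qed
  then have "is_basis_of \<U> (top_of_set A)"
    unfolding is_basis_of_def openin_topology_base_unique
    by (auto simp: \<U>_def open_box openin_open_Int)
  moreover have "hausdorff_dim (top_of_set A frontier_of U) \<le> 1 - 1" if "U \<in> \<U>" for U :: "'a set"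
  proof -
    obtain a b where U: "U = A \<inter> box a b" and ab: "\<forall>i\<in>Basis. a \<bullet> i \<in> \<rat> \<and> b \<bullet> i \<in> \<rat>"
      using \<open>U \<in> \<U>\<close> by (auto simp: \<U>_def)
    let ?F = "(\<bullet>) a ` Basis \<union> (\<bullet>) b ` Basis"
    \<comment> \<open>Passing to the subspace can only shrink the boundary.\<close>
    have "top_of_set A frontier_of U \<subseteq> A \<inter> frontier (box a b)"
      using frontier_of_subtopology_subset[of A euclidean "box a b"]
        frontier_of_restrict[of "top_of_set A" "box a b"] frontier_of_subset_topspace[of "top_of_set A" U]
      by (auto simp: U)
    then have "top_of_set A frontier_of U \<subseteq> A \<inter> hyperplane_grid ?F"
      using frontier_box_subset_hyperplane_grid by blast
    moreover have "finely_covered n (A \<inter> hyperplane_grid ?F)" for n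
      using ab by (intro assms) auto
    ultimately have "finely_covered n (top_of_set A frontier_of U)" for n
      using finely_covered_mono by blast
    then show ?thesis
      using hausdorff_dim_le_0_if_finely_covered[of "top_of_set A frontier_of U"] by simp
  qed
  ultimately show ?thesis
    using False unfolding top_hausdorff_dim_def by (auto intro!: Inf_lower)
next
  case True
  \<comment> \<open>The empty set has dimension -1 by convention.\<close>
  have "(- 1 :: ereal) \<le> 0" by simp
  also have "(0 :: ereal) \<le> 1" by simp
  finally show ?thesis using True by (simp add: top_hausdorff_dim_def)
qed

section \<open>Open and dense sets of paths\<close>

lemma dist_le_mdist_path_space:
  fixes f g :: "real \<Rightarrow> real ^ 'd::finite"
  assumes "f \<in> mspace path_space" "g \<in> mspace path_space" "t \<in> {0..1}"
  shows "dist (f t) (g t) \<le> mdist path_space f g"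
proof -
  have "compact ((\<lambda>t. dist (f t) (g t)) ` {0..1})"
    using assms by (intro compact_continuous_image continuous_intros) (auto simp: mspace_path_space)
  then show ?thesis
    using assms by (auto simp: mdist_path_space intro!: cSUP_upper bounded_imp_bdd_above compact_imp_bounded)
qed

text \<open>The bound \<open>e / 2\<close> keeps the distance strictly below \<open>e\<close> after
  passing to the supremum. Restriction makes \<open>g\<close> extensional, as elements of the space
  must be.\<close>

lemma path_space_closeI:
  fixes f g :: "real \<Rightarrow> real ^ 'd::finite"
  assumes "f \<in> mspace path_space" "continuous_on {0..1} g" "0 < e"
    and "\<And>t. t \<in> {0..1} \<Longrightarrow> dist (f t) (g t) \<le> e / 2"
  shows "restrict g {0..1} \<in> mspace path_space \<and> mdist path_space f (restrict g {0..1}) < e"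
proof
  show g: "restrict g {0..1} \<in> mspace path_space"
    using continuous_on_cong[of "{0..1}" "{0..1}" "restrict g {0..1}" g] assms(2)
    by (simp add: mspace_path_space del: restrict_apply)
      (simp add: restrict_apply')
  have "mdist path_space f (restrict g {0..1}) \<le> e / 2"
    unfolding mdist_path_space[OF assms(1) g] using assms(4) by (intro cSUP_least) auto
  then show "mdist path_space f (restrict g {0..1}) < e" using assms(3) by simp
qed

lemma openin_path_space_image_subset:
  fixes V :: "(real ^ 'd::finite) set"
  assumes "open V"
  shows "openin (mtopology_of path_space) {f \<in> mspace path_space. f ` {0..1} \<subseteq> V}"
  unfolding openin_mtopology_of_iff
proof (intro conjI ballI)
  fix f :: "real \<Rightarrow> real ^ 'd" assume f: "f \<in> {f \<in> mspace path_space. f ` {0..1} \<subseteq> V}"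
  then have "compact (f ` {0..1})"
    by (intro compact_continuous_image) (auto simp: mspace_path_space)
  \<comment> \<open>By compactness the range has a uniform neighbourhood inside \<open>V\<close>,
    and every path within distance \<open>e\<close> of \<open>f\<close> stays in it.\<close>
  then obtain e where e: "e > 0" "(\<Union>x\<in>f ` {0..1}. ball x e) \<subseteq> V"
    using f assms by (auto elim: compact_subset_open_imp_ball_epsilon_subset)
  have "g t \<in> V" if "g \<in> mspace path_space" "mdist path_space f g < e" "t \<in> {0..1}" for g t
    using e(2) that f dist_le_mdist_path_space[of f g t] by (force simp: subset_iff)
  then show "\<exists>r>0. \<forall>g\<in>mspace path_space. mdist path_space f g < r \<longrightarrow>
      g \<in> {f \<in> mspace path_space. f ` {0..1} \<subseteq> V}"
    using e(1) by (intro exI[of _ e]) auto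
qed auto

lemma openin_path_space_ends_ne:
  "openin (mtopology_of path_space) {f \<in> mspace path_space. f 0 \<noteq> (f 1 :: real ^ 'd::finite)}"
  unfolding openin_mtopology_of_iff
proof (intro conjI ballI)
  fix f :: "real \<Rightarrow> real ^ 'd" assume f: "f \<in> {f \<in> mspace path_space. f 0 \<noteq> f 1}"
  \<comment> \<open>Endpoints that each move by less than half their distance cannot meet.\<close>
  have "g 0 \<noteq> g 1" if "g \<in> mspace path_space" "mdist path_space f g < dist (f 0) (f 1) / 2" for g
    using that f dist_le_mdist_path_space[of f g 0] dist_le_mdist_path_space[of f g 1]
      dist_triangle2[of "f 0" "f 1" "g 0"] by auto
  then show "\<exists>r>0. \<forall>g\<in>mspace path_space. mdist path_space f g < r \<longrightarrow>
      g \<in> {f \<in> mspace path_space. f 0 \<noteq> f 1}"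
    using f by (intro exI[of _ "dist (f 0) (f 1) / 2"]) auto
qed auto

lemma closure_of_path_space_ends_ne:
  "mtopology_of path_space closure_of {f \<in> mspace path_space. f 0 \<noteq> (f 1 :: real ^ 'd::finite)} =
     mspace path_space"
proof (rule closure_of_mtopology_of_eq_mspace)
  fix f :: "real \<Rightarrow> real ^ 'd" and e :: real
  assume f: "f \<in> mspace path_space" and e: "0 < e"
  obtain v :: "real ^ 'd" where v: "norm v = e / 2"
    using e by (meson half_gt_zero less_imp_le vector_choose_size)
  show "\<exists>g\<in>{f \<in> mspace path_space. f 0 \<noteq> f 1}. g \<in> mspace path_space \<and> mdist path_space f g < e"
  proof (cases "f 0 = f 1")
    case True
    have "v \<noteq> 0" using v e by auto
    \<comment> \<open>The added term fixes \<open>f 0\<close>, moves \<open>f 1\<close> by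
      \<open>v\<close>, and never exceeds \<open>norm v = e / 2\<close>.\<close>
    have "restrict (\<lambda>t. f t + t *\<^sub>R v) {0..1} \<in> mspace path_space \<and>
        mdist path_space f (restrict (\<lambda>t. f t + t *\<^sub>R v) {0..1}) < e"
      using f e v by (intro path_space_closeI)
        (auto simp: mspace_path_space dist_norm mult_left_le_one_le intro!: continuous_intros)
    then show ?thesis
      using True \<open>v \<noteq> 0\<close> by (intro bexI) auto
  next
    case False
    then show ?thesis using f e by (intro bexI[of _ f]) (auto simp: mdist_zero[THEN iffD2])
  qed
qed

section \<open>Polynomial paths and grids\<close>

lemma finite_real_polynomial_function_roots:
  fixes h :: "real \<Rightarrow> real"
  assumes "real_polynomial_function h" "h a \<noteq> 0"
  shows "finite {t. h t = 0}"
proof -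
  obtain c n where h: "h = (\<lambda>x. \<Sum>i\<le>n. c i * x ^ i)"
    using assms(1) real_polynomial_function_iff_sum by blast
  then have "\<exists>i\<le>n. c i \<noteq> 0"
    using assms(2) by (metis (no_types, lifting) atMost_iff mult_zero_left sum.neutral)
  then show ?thesis
    unfolding h using polyfun_finite_roots by blast
qed

text \<open>A polynomial path close to \<open>f\<close> is shifted along the diagonal so that its starting point
  avoids the grid; then no coordinate is constantly equal to an element of \<open>F\<close>.\<close>

lemma finite_grid_preimage_approx:
  fixes f :: "real \<Rightarrow> 'a::euclidean_space"
  assumes "continuous_on {0..1} f" "finite F" "0 < e"
  obtains g where "continuous_on {0..1} g" "\<And>t. t \<in> {0..1} \<Longrightarrow> dist (f t) (g t) < e"
    "finite {t. g t \<in> hyperplane_grid F}"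
proof -
  obtain h where h: "polynomial_function h" "\<And>t. t \<in> {0..1} \<Longrightarrow> norm (f t - h t) < e / 2"
    using Stone_Weierstrass_polynomial_function[OF _ assms(1), of "e / 2"] assms(3) by auto
  \<comment> \<open>\<open>B\<close> collects the finitely many shifts that would put the starting
    point on the grid.\<close>
  define B where "B = (\<Union>i\<in>Basis. (\<lambda>q. q - h 0 \<bullet> i) ` F)"
  have pos: "0 < norm (One :: 'a)"
    by simp
  \<comment> \<open>The upper end of the interval keeps the shift by
    \<open>\<delta> *\<^sub>R One\<close> shorter than \<open>e / 2\<close>, the other half of the
    error budget.\<close>
  have "infinite ({0<..<e / (2 * norm (One :: 'a))} - B)"
    using assms pos by (intro Diff_infinite_finite) (auto simp: B_def intro!: infinite_Ioo)
  then obtain \<delta> where "\<delta> \<in> {0<..<e / (2 * norm (One :: 'a))} - B"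
    using infinite_imp_nonempty by blast
  then have \<delta>: "0 < \<delta>" "\<delta> < e / (2 * norm (One :: 'a))" "\<delta> \<notin> B"
    by auto
  define g where "g t = h t + \<delta> *\<^sub>R One" for t
  show thesis
  proof
    show "continuous_on {0..1} g"
      unfolding g_def using h(1) by (intro continuous_intros continuous_on_polymonial_function)
    show "dist (f t) (g t) < e" if "t \<in> {0..1}" for t
    proof -
      have "norm (f t - g t) \<le> norm (f t - h t) + norm (\<delta> *\<^sub>R (One :: 'a))"
        unfolding g_def by (metis diff_diff_eq norm_triangle_ineq4)
      also have "norm (\<delta> *\<^sub>R (One :: 'a)) < e / 2"
        using \<delta>(1,2) pos by (simp add: field_simps)
      finally show ?thesis using h(2)[OF that] by (simp add: dist_norm)
    qed
    \<comment> \<open>Each coordinate of \<open>g\<close> minus \<open>q\<close> is a polynomial in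
      \<open>t\<close> that does not vanish at 0, by the choice of \<open>\<delta>\<close>.\<close>
    have "finite {t. g t \<bullet> i - q = 0}" if "i \<in> Basis" "q \<in> F" for i q
    proof (rule finite_real_polynomial_function_roots)
      have "real_polynomial_function (\<lambda>t. h t \<bullet> i)"
        using h(1) that polynomial_function_iff_Basis_inner by blast
      then have "real_polynomial_function (\<lambda>t. (h t \<bullet> i + \<delta>) - q)"
        by (intro real_polynomial_function_diff real_polynomial_function.intros(2,3))
      then show "real_polynomial_function (\<lambda>t. g t \<bullet> i - q)"
        using that by (simp add: g_def inner_add_left)
      have "\<delta> \<noteq> q - h 0 \<bullet> i"
        using \<delta>(3) that by (auto simp: B_def)
      then show "g 0 \<bullet> i - q \<noteq> 0"
        using that by (simp add: g_def inner_add_left)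
    qed
    then have "finite (\<Union>i\<in>Basis. \<Union>q\<in>F. {t. g t \<bullet> i - q = 0})"
      using assms(2) by auto
    moreover have "{t. g t \<in> hyperplane_grid F} = (\<Union>i\<in>Basis. \<Union>q\<in>F. {t. g t \<bullet> i - q = 0})"
      by (auto simp: hyperplane_grid_def)
    ultimately show "finite {t. g t \<in> hyperplane_grid F}" by simp
  qed
qed

definition grid_fine_paths :: "real set \<Rightarrow> nat \<Rightarrow> (real \<Rightarrow> real ^ 'd::finite) set" where
  "grid_fine_paths F n =
     {f \<in> mspace path_space. finely_covered n (f ` {0..1} \<inter> hyperplane_grid F)}"

text \<open>Let \<open>U\<close> be an open, finely covered set around the part of the range on the
  grid. The range lies in the open set \<open>U \<union> - hyperplane_grid F\<close>, and any path
  that stays there meets the grid only inside \<open>U\<close>.\<close>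

lemma openin_grid_fine_paths:
  assumes "finite F"
  shows "openin (mtopology_of path_space) (grid_fine_paths F n :: (real \<Rightarrow> real ^ 'd::finite) set)"
proof (subst openin_subopen, intro ballI)
  fix f :: "real \<Rightarrow> real ^ 'd" assume "f \<in> grid_fine_paths F n"
  then have f: "f \<in> mspace path_space" "finely_covered n (f ` {0..1} \<inter> hyperplane_grid F)"
    by (auto simp: grid_fine_paths_def)
  from f(2) obtain U where U: "open U" "f ` {0..1} \<inter> hyperplane_grid F \<subseteq> U" "finely_covered n U"
    by (rule finely_covered_open)
  let ?T = "{f \<in> mspace path_space. f ` {0..1} \<subseteq> U \<union> - hyperplane_grid F}"
  have "openin (mtopology_of path_space) ?T"
    using U(1) closed_hyperplane_grid[OF assms] by (intro openin_path_space_image_subset) auto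
  moreover have "f \<in> ?T" using f U(2) by auto
  moreover have "?T \<subseteq> grid_fine_paths F n"
    using U(3) by (auto simp: grid_fine_paths_def intro: finely_covered_mono)
  ultimately show "\<exists>T. openin (mtopology_of path_space) T \<and> f \<in> T \<and> T \<subseteq> grid_fine_paths F n"
    by blast
qed

text \<open>The approximating path meets the grid at finitely many parameters, hence in a finite
  set, and finite sets are finely covered for every \<open>n\<close>.\<close>

lemma closure_of_grid_fine_paths:
  assumes "finite F"
  shows "mtopology_of path_space closure_of (grid_fine_paths F n :: (real \<Rightarrow> real ^ 'd::finite) set) =
    mspace path_space"
proof (rule closure_of_mtopology_of_eq_mspace)
  fix f :: "real \<Rightarrow> real ^ 'd" and e :: real
  assume f: "f \<in> mspace path_space" and e: "0 < e"
  then have "continuous_on {0..1} f" by (simp add: mspace_path_space)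
  then obtain g where g: "continuous_on {0..1} g" "\<And>t. t \<in> {0..1} \<Longrightarrow> dist (f t) (g t) < e / 2"
    "finite {t. g t \<in> hyperplane_grid F}"
    using finite_grid_preimage_approx[OF _ assms, of f "e / 2"] e by auto
  have *: "restrict g {0..1} \<in> mspace path_space \<and> mdist path_space f (restrict g {0..1}) < e"
    using f g e by (intro path_space_closeI) (auto intro: less_imp_le)
  have "restrict g {0..1} ` {0..1} \<inter> hyperplane_grid F \<subseteq> g ` {t. g t \<in> hyperplane_grid F}"
    by auto
  then have "finely_covered n (restrict g {0..1} ` {0..1} \<inter> hyperplane_grid F)"
    using g(3) by (intro finite_imp_finely_covered) (meson finite_imageI finite_subset)
  then show "\<exists>y\<in>grid_fine_paths F n. y \<in> mspace path_space \<and> mdist path_space f y < e"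
    using * by (intro bexI[of _ "restrict g {0..1}"]) (auto simp: grid_fine_paths_def)
qed

theorem theorem5p13:
  shows "comeager_in (mtopology_of (path_space :: (real \<Rightarrow> real ^ 'd::finite) metric))
    {f \<in> mspace path_space. top_hausdorff_dim (f ` {0..1}) = 1}"
proof -
  let ?ends = "{f \<in> mspace path_space. f 0 \<noteq> (f 1 :: real ^ 'd)}"
  let ?I = "{F. finite F \<and> F \<subseteq> (\<rat> :: real set)} \<times> (UNIV :: nat set)"
  \<comment> \<open>The family is countable because the rationals have only countably many finite
    subsets. The set \<open>?ends\<close> supplies two distinct points of the range for the lower
    bound; the other sets give the upper bound.\<close>
  define \<W> where "\<W> = insert ?ends ((\<lambda>(F, n). grid_fine_paths F n) ` ?I)"
  show ?thesis
  proof (rule comeager_in_if_countable_Inter_open_dense)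
    show "countable \<W>"
      unfolding \<W>_def using countable_rat
      by (intro countable_insert countable_image countable_SIGMA countable_Collect_finite_subset) auto
    show "\<W> \<noteq> {}" by (simp add: \<W>_def)
    show "openin (mtopology_of path_space) W \<and>
        mtopology_of path_space closure_of W = topspace (mtopology_of path_space)" if "W \<in> \<W>" for W
      using that unfolding \<W>_def
      by (elim insertE imageE) (auto simp: openin_path_space_ends_ne closure_of_path_space_ends_ne
        openin_grid_fine_paths closure_of_grid_fine_paths)
    show "\<Inter>\<W> \<subseteq> {f \<in> mspace path_space. top_hausdorff_dim (f ` {0..1}) = 1}"
    proof
      fix f assume f: "f \<in> \<Inter>\<W>"
      then have ends: "f \<in> mspace path_space" "f 0 \<noteq> f 1" by (auto simp: \<W>_def)
      have "finely_covered n (f ` {0..1} \<inter> hyperplane_grid F)" if "finite F" "F \<subseteq> \<rat>" for n F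
        using f that unfolding \<W>_def grid_fine_paths_def by fastforce
      then have le: "top_hausdorff_dim (f ` {0..1}) \<le> 1"
        by (rule top_hausdorff_dim_le_1)
      have conn: "connected (f ` {0..1})"
        using ends(1) by (intro connected_continuous_image) (auto simp: mspace_path_space)
      have "1 \<le> top_hausdorff_dim (f ` {0..1})"
        using ends(2) by (intro top_hausdorff_dim_ge_1[OF conn, of "f 0" "f 1"]) auto
      with le show "f \<in> {f \<in> mspace path_space. top_hausdorff_dim (f ` {0..1}) = 1}"
        using ends(1) by auto
    qed
  qed auto
qed

end
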